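(* Let $G$ be a connected infinite graph. Then $\chi''_D(G)\leq \chi''(G)+1$, where $\chi''_D(G)$ is the total distinguishing chromatic number and $\chi''(G)$ is the total chromatic number of $G$.
   Context: Graphs are simple and undirected; a graph is infinite if it has infinitely many vertices (no countability or local finiteness is assumed). A proper total colouring of $G$ is a colouring $c$ of $V(G)\cup E(G)$ in which adjacent vertices have distinct colours, edges sharing an endpoint have distinct colours, and every edge has a colour distinct from those of its endpoints. The total chromatic number $\chi''(G)$ is the least cardinal number of colours in a proper total colouring of $G$. The total distinguishing chromatic number $\chi''_D(G)$ is the least cardinal number of colours in a proper total colouring of $G$ that is preserved only by the trivial automorphism, where an automorphism $\varphi$ preserves $c$ if $c(\varphi(v))=c(v)$ for all vertices $v$ and $c(\varphi(x)\varphi(y))=c(xy)$ for all edges $xy$. These invariants may be infinite cardinals. *)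

theory Defs
  imports Main
begin

unbundle cardinal_syntax

section \<open>Graphs\<close>

text \<open>Vertex and edge sets of any cardinality; an edge is the set of its two endpoints.\<close>

definition simple_graph :: "'a set \<Rightarrow> 'a set set \<Rightarrow> bool" where
  "simple_graph V E \<longleftrightarrow> (\<forall>e\<in>E. \<exists>u\<in>V. \<exists>v\<in>V. u \<noteq> v \<and> e = {u, v})"

definition connected_graph :: "'a set \<Rightarrow> 'a set set \<Rightarrow> bool" where
  "connected_graph V E \<longleftrightarrow>
     V \<noteq> {} \<and> (\<forall>u\<in>V. \<forall>v\<in>V. (u, v) \<in> {(x, y). {x, y} \<in> E}\<^sup>*)"

text \<open>Only the values of an automorphism on \<open>V\<close> matter.\<close>

definition graph_automorphism :: "'a set \<Rightarrow> 'a set set \<Rightarrow> ('a \<Rightarrow> 'a) \<Rightarrow> bool" where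
  "graph_automorphism V E \<phi> \<longleftrightarrow>
     bij_betw \<phi> V V \<and> (\<forall>x\<in>V. \<forall>y\<in>V. {x, y} \<in> E \<longleftrightarrow> {\<phi> x, \<phi> y} \<in> E)"

section \<open>Total colourings\<close>

text \<open>The coloured objects \<open>V(G) \<union> E(G)\<close> form the disjoint sum \<open>V <+> E\<close>: a vertex \<open>v\<close> has
  colour \<open>c (Inl v)\<close>, an edge \<open>e\<close> has colour \<open>c (Inr e)\<close>.\<close>

definition proper_total_colouring ::
  "'a set \<Rightarrow> 'a set set \<Rightarrow> ('a + 'a set \<Rightarrow> 'c) \<Rightarrow> bool" where
  "proper_total_colouring V E c \<longleftrightarrow>
     (\<forall>u\<in>V. \<forall>v\<in>V. {u, v} \<in> E \<longrightarrow> c (Inl u) \<noteq> c (Inl v)) \<and>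
     (\<forall>e\<in>E. \<forall>f\<in>E. e \<noteq> f \<and> e \<inter> f \<noteq> {} \<longrightarrow> c (Inr e) \<noteq> c (Inr f)) \<and>
     (\<forall>e\<in>E. \<forall>v\<in>e. c (Inr e) \<noteq> c (Inl v))"

definition preserves_colouring ::
  "'a set \<Rightarrow> 'a set set \<Rightarrow> ('a + 'a set \<Rightarrow> 'c) \<Rightarrow> ('a \<Rightarrow> 'a) \<Rightarrow> bool" where
  "preserves_colouring V E c \<phi> \<longleftrightarrow>
     (\<forall>v\<in>V. c (Inl (\<phi> v)) = c (Inl v)) \<and>
     (\<forall>x\<in>V. \<forall>y\<in>V. {x, y} \<in> E \<longrightarrow> c (Inr {\<phi> x, \<phi> y}) = c (Inr {x, y}))"

definition distinguishing_colouring ::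
  "'a set \<Rightarrow> 'a set set \<Rightarrow> ('a + 'a set \<Rightarrow> 'c) \<Rightarrow> bool" where
  "distinguishing_colouring V E c \<longleftrightarrow>
     (\<forall>\<phi>. graph_automorphism V E \<phi> \<and> preserves_colouring V E c \<phi> \<longrightarrow> (\<forall>v\<in>V. \<phi> v = v))"

abbreviation number_of_colours ::
  "'a set \<Rightarrow> 'a set set \<Rightarrow> ('a + 'a set \<Rightarrow> 'c) \<Rightarrow> 'c rel" where
  "number_of_colours V E c \<equiv> |c ` (V <+> E)|"

section \<open>Total chromatic numbers\<close>

text \<open>Cardinals are cardinal orders, compared by \<open>\<le>o\<close>; the least one in a set is determined up to
  \<open>=o\<close>. Colours are taken from the type \<open>'a + 'a set\<close>, which loses nothing: a colouring uses at
  most as many colours as there are coloured objects. Lemmas \<open>total_chromatic_number_least\<close> and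
  \<open>total_distinguishing_chromatic_number_least\<close> below state minimality for an arbitrary colour
  type.\<close>

definition least_cardinal :: "'k rel set \<Rightarrow> 'k rel" where
  "least_cardinal R = (SOME r. r \<in> R \<and> (\<forall>r'\<in>R. r \<le>o r'))"

definition total_chromatic_number :: "'a set \<Rightarrow> 'a set set \<Rightarrow> ('a + 'a set) rel" where
  "total_chromatic_number V E =
     least_cardinal {number_of_colours V E c | c :: 'a + 'a set \<Rightarrow> 'a + 'a set.
       proper_total_colouring V E c}"

definition total_distinguishing_chromatic_number ::
  "'a set \<Rightarrow> 'a set set \<Rightarrow> ('a + 'a set) rel" where
  "total_distinguishing_chromatic_number V E =
     least_cardinal {number_of_colours V E c | c :: 'a + 'a set \<Rightarrow> 'a + 'a set.
       proper_total_colouring V E c \<and> distinguishing_colouring V E c}"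

lemma least_cardinal:
  assumes "R \<noteq> {}" and "\<forall>r\<in>R. Card_order r"
  shows "least_cardinal R \<in> R" and "\<And>r. r \<in> R \<Longrightarrow> least_cardinal R \<le>o r"
proof -
  have "\<exists>r. r \<in> R \<and> (\<forall>r'\<in>R. r \<le>o r')"
    using exists_minim_Card_order[of R] assms by blast
  then have *: "least_cardinal R \<in> R \<and> (\<forall>r'\<in>R. least_cardinal R \<le>o r')"
    unfolding least_cardinal_def by (rule someI_ex)
  show "least_cardinal R \<in> R" using * by blast
  show "\<And>r. r \<in> R \<Longrightarrow> least_cardinal R \<le>o r" using * by blast
qed

lemma proper_total_colouring_cong:
  assumes "simple_graph V E" and "proper_total_colouring V E c"
    and "\<And>s t. s \<in> V <+> E \<Longrightarrow> t \<in> V <+> E \<Longrightarrow> d s = d t \<Longrightarrow> c s = c t"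
  shows "proper_total_colouring V E d"
  unfolding proper_total_colouring_def
proof (intro conjI ballI impI notI)
  fix u v assume "u \<in> V" "v \<in> V" "{u, v} \<in> E" "d (Inl u) = d (Inl v)"
  then show False
    using assms(2) assms(3)[of "Inl u" "Inl v"] by (auto simp: proper_total_colouring_def)
next
  fix e f assume "e \<in> E" "f \<in> E" "e \<noteq> f \<and> e \<inter> f \<noteq> {}" "d (Inr e) = d (Inr f)"
  moreover from this have "c (Inr e) = c (Inr f)"
    using assms(3)[of "Inr e" "Inr f"] by auto
  ultimately show False
    using assms(2) by (auto simp: proper_total_colouring_def)
next
  fix e v assume a: "e \<in> E" "v \<in> e" "d (Inr e) = d (Inl v)"
  obtain x y where "x \<in> V" "y \<in> V" "e = {x, y}"
    using assms(1) a(1) unfolding simple_graph_def by meson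
  then have "v \<in> V" using a(2) by auto
  then have "c (Inr e) = c (Inl v)" using a assms(3)[of "Inr e" "Inl v"] by auto
  then show False using a assms(2) by (auto simp: proper_total_colouring_def)
qed

lemma distinguishing_colouring_cong:
  assumes "distinguishing_colouring V E c"
    and "\<And>s t. s \<in> V <+> E \<Longrightarrow> t \<in> V <+> E \<Longrightarrow> d s = d t \<Longrightarrow> c s = c t"
  shows "distinguishing_colouring V E d"
  unfolding distinguishing_colouring_def
proof (intro allI impI)
  fix \<phi> assume a: "graph_automorphism V E \<phi> \<and> preserves_colouring V E d \<phi>"
  then have \<phi>: "\<And>v. v \<in> V \<Longrightarrow> \<phi> v \<in> V"
    "\<And>x y. x \<in> V \<Longrightarrow> y \<in> V \<Longrightarrow> {x, y} \<in> E \<Longrightarrow> {\<phi> x, \<phi> y} \<in> E"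
    unfolding graph_automorphism_def by (blast dest: bij_betwE)+
  have "preserves_colouring V E c \<phi>"
    unfolding preserves_colouring_def
  proof (intro conjI ballI impI)
    fix v assume "v \<in> V"
    then show "c (Inl (\<phi> v)) = c (Inl v)"
      using a \<phi>(1) by (intro assms(2)) (simp_all add: preserves_colouring_def InlI InrI)
  next
    fix x y assume "x \<in> V" "y \<in> V" "{x, y} \<in> E"
    then show "c (Inr {\<phi> x, \<phi> y}) = c (Inr {x, y})"
      using a \<phi>(2) by (intro assms(2)) (simp_all add: preserves_colouring_def InlI InrI)
  qed
  then show "\<forall>v\<in>V. \<phi> v = v"
    using a assms(1) by (auto simp: distinguishing_colouring_def)
qed

lemma recolour:
  fixes c :: "'s \<Rightarrow> 'c" and T :: "'s set"
  defines "d \<equiv> inv_into T c \<circ> c"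
  shows "|d ` T| \<le>o |c ` T|"
    and "\<And>s t. s \<in> T \<Longrightarrow> t \<in> T \<Longrightarrow> d s = d t \<Longrightarrow> c s = c t"
proof -
  show "|d ` T| \<le>o |c ` T|"
    unfolding d_def image_comp[symmetric] by (rule card_of_image)
  show "c s = c t" if "s \<in> T" "t \<in> T" "d s = d t" for s t
    using that inv_into_injective[of T c "c s" "c t"] by (simp add: d_def)
qed

lemma proper_total_colouring_id:
  assumes "simple_graph V E"
  shows "proper_total_colouring V E id"
proof -
  have "{v} \<notin> E" for v
  proof
    assume "{v} \<in> E"
    then obtain x y where "x \<noteq> y" "{v} = {x, y}"
      using assms unfolding simple_graph_def by meson
    then show False by auto
  qed
  then show ?thesis by (auto simp: proper_total_colouring_def)
qed

lemma distinguishing_colouring_id: "distinguishing_colouring V E id"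
  unfolding distinguishing_colouring_def preserves_colouring_def id_apply sum.inject by blast

theorem total_chromatic_number_least:
  fixes V :: "'a set" and c :: "'a + 'a set \<Rightarrow> 'c"
  assumes "simple_graph V E"
  shows "\<exists>d :: 'a + 'a set \<Rightarrow> 'a + 'a set. proper_total_colouring V E d \<and>
           total_chromatic_number V E = number_of_colours V E d"
    and "proper_total_colouring V E c \<Longrightarrow>
           total_chromatic_number V E \<le>o number_of_colours V E c"
proof -
  let ?R = "{number_of_colours V E d | d :: 'a + 'a set \<Rightarrow> 'a + 'a set.
    proper_total_colouring V E d}"
  have R: "?R \<noteq> {}" "\<forall>r\<in>?R. Card_order r"
    using proper_total_colouring_id[OF assms] by (auto simp: card_of_Card_order)
  show "\<exists>d :: 'a + 'a set \<Rightarrow> 'a + 'a set. proper_total_colouring V E d \<and>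
      total_chromatic_number V E = number_of_colours V E d"
    using least_cardinal(1)[OF R] unfolding total_chromatic_number_def by blast
  assume c: "proper_total_colouring V E c"
  let ?d = "inv_into (V <+> E) c \<circ> c"
  have "proper_total_colouring V E ?d"
    by (rule proper_total_colouring_cong[OF assms c recolour(2)[of _ "V <+> E" _ c]])
  then have "number_of_colours V E ?d \<in> ?R" by (intro CollectI exI[of _ ?d] conjI refl)
  then have "total_chromatic_number V E \<le>o number_of_colours V E ?d"
    unfolding total_chromatic_number_def by (rule least_cardinal(2)[OF R])
  then show "total_chromatic_number V E \<le>o number_of_colours V E c"
    using recolour(1) by (rule ordLeq_transitive)
qed

theorem total_distinguishing_chromatic_number_least:
  fixes V :: "'a set" and c :: "'a + 'a set \<Rightarrow> 'c"
  assumes "simple_graph V E"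
  shows "\<exists>d :: 'a + 'a set \<Rightarrow> 'a + 'a set.
           proper_total_colouring V E d \<and> distinguishing_colouring V E d \<and>
           total_distinguishing_chromatic_number V E = number_of_colours V E d"
    and "proper_total_colouring V E c \<Longrightarrow> distinguishing_colouring V E c \<Longrightarrow>
           total_distinguishing_chromatic_number V E \<le>o number_of_colours V E c"
proof -
  let ?R = "{number_of_colours V E d | d :: 'a + 'a set \<Rightarrow> 'a + 'a set.
    proper_total_colouring V E d \<and> distinguishing_colouring V E d}"
  have R: "?R \<noteq> {}" "\<forall>r\<in>?R. Card_order r"
    using proper_total_colouring_id[OF assms] distinguishing_colouring_id
    by (auto simp: card_of_Card_order)
  show "\<exists>d :: 'a + 'a set \<Rightarrow> 'a + 'a set.
      proper_total_colouring V E d \<and> distinguishing_colouring V E d \<and>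
      total_distinguishing_chromatic_number V E = number_of_colours V E d"
    using least_cardinal(1)[OF R] unfolding total_distinguishing_chromatic_number_def by blast
  assume c: "proper_total_colouring V E c" "distinguishing_colouring V E c"
  let ?d = "inv_into (V <+> E) c \<circ> c"
  have "proper_total_colouring V E ?d"
    by (rule proper_total_colouring_cong[OF assms c(1) recolour(2)[of _ "V <+> E" _ c]])
  moreover have "distinguishing_colouring V E ?d"
    by (rule distinguishing_colouring_cong[OF c(2) recolour(2)[of _ "V <+> E" _ c]])
  ultimately have "number_of_colours V E ?d \<in> ?R" by (intro CollectI exI[of _ ?d] conjI refl)
  then have "total_distinguishing_chromatic_number V E \<le>o number_of_colours V E ?d"
    unfolding total_distinguishing_chromatic_number_def by (rule least_cardinal(2)[OF R])
  then show "total_distinguishing_chromatic_number V E \<le>o number_of_colours V E c"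
    using recolour(1) by (rule ordLeq_transitive)
qed

end

(* Recolour a single vertex with a new colour. A preserving automorphism fixes that vertex, and
   since the edges at a vertex have distinct colours, it fixes all neighbours of a fixed vertex;
   by connectedness it is trivial. *)
theory Submission
  imports Defs
begin

lemma preserving_automorphism_fixes_neighbour:
  assumes c: "proper_total_colouring V E c"
    and \<phi>: "graph_automorphism V E \<phi>" "preserves_colouring V E c \<phi>"
    and xy: "x \<in> V" "y \<in> V" "{x, y} \<in> E" and fixed: "\<phi> x = x"
  shows "\<phi> y = y"
proof -
  \<comment> \<open>Writing \<open>x\<close> as \<open>\<phi> x\<close> turns this pair into the
    image of the edge \<open>{x, y}\<close>.\<close>
  have "{x, \<phi> y} \<in> E"
    using \<phi>(1) xy unfolding graph_automorphism_def by (subst fixed[symmetric]) blast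
  moreover have "{x, \<phi> y} \<inter> {x, y} \<noteq> {}"
    by simp
  moreover have "c (Inr {x, \<phi> y}) = c (Inr {x, y})"
    using \<phi>(2) xy unfolding preserves_colouring_def by (subst fixed[symmetric]) blast
  ultimately have "{x, \<phi> y} = {x, y}"
    using c xy(3) unfolding proper_total_colouring_def by meson
  then show ?thesis by (auto simp: doubleton_eq_iff)
qed

text \<open>The unique colour pins \<open>v\<close>, and fixedness then spreads from
  \<open>v\<close> along walks to every vertex.\<close>

lemma distinguishing_if_unique_vertex_colour:
  assumes G: "simple_graph V E" "connected_graph V E"
    and c: "proper_total_colouring V E c"
    and v: "v \<in> V" and unique: "\<And>u. u \<in> V \<Longrightarrow> c (Inl u) = c (Inl v) \<Longrightarrow> u = v"
  shows "distinguishing_colouring V E c"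
  unfolding distinguishing_colouring_def
proof (intro allI impI ballI)
  fix \<phi> u
  assume \<phi>: "graph_automorphism V E \<phi> \<and> preserves_colouring V E c \<phi>" and "u \<in> V"
  \<comment> \<open>The reachability relation mentions only \<open>E\<close>, so each induction step
    must recover that its endpoints lie in \<open>V\<close>.\<close>
  have edge: "x \<in> V \<and> y \<in> V" if "{x, y} \<in> E" for x y
    using G(1) that unfolding simple_graph_def by (fastforce simp: doubleton_eq_iff)
  have "\<phi> v \<in> V" "c (Inl (\<phi> v)) = c (Inl v)"
    using \<phi> v unfolding graph_automorphism_def preserves_colouring_def by (auto dest: bij_betwE)
  then have "\<phi> v = v" by (rule unique)
  have "(v, u) \<in> {(x, y). {x, y} \<in> E}\<^sup>*"
    using G(2) v \<open>u \<in> V\<close> unfolding connected_graph_def by blast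
  then show "\<phi> u = u"
  proof induction
    case base
    show ?case by fact
  next
    case (step x y)
    then show ?case
      using preserving_automorphism_fixes_neighbour[OF c] \<phi> edge by blast
  qed
qed

text \<open>The option type supplies the new colour: \<open>None\<close> differs from every old
  colour \<open>Some _\<close>, so recolouring \<open>v\<close> creates no clash.\<close>

lemma proper_total_colouring_new_vertex_colour:
  assumes G: "simple_graph V E" and c: "proper_total_colouring V E c"
  shows "proper_total_colouring V E ((Some \<circ> c)(Inl v := None))"
proof -
  \<comment> \<open>A loop at \<open>v\<close> would demand
    \<open>None \<noteq> None\<close>.\<close>
  have "{v} \<notin> E"
    using G unfolding simple_graph_def by fastforce
  then show ?thesis
    using c unfolding proper_total_colouring_def by auto
qed

lemma card_of_insert_ordLeq_csum_cone: "|insert None (Some ` A)| \<le>o |A| +c cone"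
proof -
  \<comment> \<open>The single point of \<open>cone\<close> is sent to \<open>None\<close>.\<close>
  have "insert None (Some ` A) = case_sum Some (\<lambda>_. None) ` (A <+> {()})"
    by (auto simp: Plus_def image_Un image_image)
  then show ?thesis
    by (simp only: csum_def cone_def Field_card_of card_of_image)
qed

theorem theorem13:
  fixes V :: "'a set" and E :: "'a set set"
  assumes "simple_graph V E"
    and "connected_graph V E"
    and "infinite V"
  shows "total_distinguishing_chromatic_number V E \<le>o total_chromatic_number V E +c cone"
proof -
  obtain c :: "'a + 'a set \<Rightarrow> 'a + 'a set" where c: "proper_total_colouring V E c"
    "total_chromatic_number V E = number_of_colours V E c"
    using total_chromatic_number_least(1)[OF assms(1)] by blast
  obtain v where v: "v \<in> V"
    using assms(2) unfolding connected_graph_def by blast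
  let ?d = "(Some \<circ> c)(Inl v := None)"
  have proper: "proper_total_colouring V E ?d"
    by (rule proper_total_colouring_new_vertex_colour[OF assms(1) c(1)])
  have "distinguishing_colouring V E ?d"
    by (rule distinguishing_if_unique_vertex_colour[OF assms(1,2) proper v])
      (simp split: if_splits)
  \<comment> \<open>Minimality holds for any colour type, in particular for the option type of
    \<open>?d\<close>.\<close>
  then have "total_distinguishing_chromatic_number V E \<le>o number_of_colours V E ?d"
    by (rule total_distinguishing_chromatic_number_least(2)[OF assms(1) proper])
  \<comment> \<open>Only an inclusion of colour sets: the old colour of \<open>v\<close> may no
    longer occur.\<close>
  also have "number_of_colours V E ?d \<le>o |insert None (Some ` c ` (V <+> E))|"
    by (rule card_of_mono1) auto
  also have "|insert None (Some ` c ` (V <+> E))| \<le>o total_chromatic_number V E +c cone"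
    unfolding c(2) by (rule card_of_insert_ordLeq_csum_cone)
  finally show ?thesis .
qed

end
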